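(* For any integers $n\geq 1$ and $1\leq \ell\leq n+1$, the subgraph of the $(2n+1)$-cube $Q_{2n+1}$ induced by the middle $2\ell$ levels, i.e., by all bitstrings of length $2n+1$ with Hamming weight in the interval $[n+1-\ell,n+\ell]$, has a cycle factor.
   Context: The $n$-cube $Q_n$ is the graph whose vertices are all bitstrings of length $n$, with an edge between any two bitstrings that differ in exactly one bit. The Hamming weight of a bitstring is its number of 1-bits. The $k$th level of $Q_n$ is the set of all bitstrings of length $n$ with Hamming weight exactly $k$. A cycle factor of a graph is a collection of pairwise vertex-disjoint cycles (in the usual simple-graph sense) which together visit all vertices of the graph. *)

theory Defs
  imports Main
begin

text \<open>A simple graph is given by its vertex set and its edges, each edge being a two-element set
  of vertices.\<close>

type_synonym 'a sgraph = "'a set \<times> 'a set set"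

abbreviation vertices :: "'a sgraph \<Rightarrow> 'a set" where
  "vertices \<equiv> fst"

abbreviation edges :: "'a sgraph \<Rightarrow> 'a set set" where
  "edges \<equiv> snd"

definition induced_subgraph :: "'a sgraph \<Rightarrow> 'a set \<Rightarrow> 'a sgraph" where
  "induced_subgraph G W = (vertices G \<inter> W, {e \<in> edges G. e \<subseteq> W})"

text \<open>A cycle is given by the list of its vertices in cyclic order, without repeating the first
  vertex at the end. The length bound excludes traversing a single edge back and forth.\<close>

definition is_cycle :: "'a sgraph \<Rightarrow> 'a list \<Rightarrow> bool" where
  "is_cycle G c \<longleftrightarrow> length c \<ge> 3 \<and> distinct c \<and> set c \<subseteq> vertices G \<and>
     (\<forall>i < length c. {c ! i, c ! (Suc i mod length c)} \<in> edges G)"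

definition is_cycle_factor :: "'a sgraph \<Rightarrow> 'a list set \<Rightarrow> bool" where
  "is_cycle_factor G C \<longleftrightarrow> (\<forall>c\<in>C. is_cycle G c) \<and>
     (\<forall>c\<in>C. \<forall>d\<in>C. c \<noteq> d \<longrightarrow> set c \<inter> set d = {}) \<and>
     (\<Union>c\<in>C. set c) = vertices G"

definition bitstrings :: "nat \<Rightarrow> bool list set" where
  "bitstrings n = {x. length x = n}"

definition cube :: "nat \<Rightarrow> bool list sgraph" where
  "cube n = (bitstrings n,
     {{x, y} | x y. x \<in> bitstrings n \<and> y \<in> bitstrings n \<and> card {i. i < n \<and> x ! i \<noteq> y ! i} = 1})"

definition hamming_weight :: "bool list \<Rightarrow> nat" where
  "hamming_weight x = count_list x True"

definition level :: "nat \<Rightarrow> nat \<Rightarrow> bool list set" where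
  "level n k = {x \<in> bitstrings n. hamming_weight x = k}"

end

theory Submission
  imports Defs "HOL-Combinatorics.Cycles"
begin

text \<open>
  Two perfect matchings of a bipartite graph without a common edge form a cycle factor: walking
  alternately along the two matchings closes up into cycles, and none of them runs back and forth
  on a single edge. So it is enough to find two such matchings.

  Read a bitstring as a sequence of brackets, 1 opening and 0 closing. After matching brackets,
  the unmatched bits read \<open>0\<dots>01\<dots>1\<close>. Turning the last unmatched 0 into a 1 does not change the
  matched pairs, so repeating this step partitions the cube into chains (the symmetric chain
  decomposition of Greene and Kleitman). In dimension \<open>N\<close> a chain with \<open>m\<close> matched pairs visits
  each of the levels \<open>m, \<dots>, N - m\<close> once. If \<open>N\<close> is odd, the number of vertices of this chain
  in the levels \<open>a, \<dots>, N - a\<close> is therefore even, and pairing them off from the bottom gives a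
  perfect matching of these levels along edges of the chains (lemmas \<open>partner_in_middle_levels\<close>
  and \<open>partner_partner\<close>).

  The second matching is the image of the first one under complementation, which maps the
  levels \<open>a, \<dots>, N - a\<close> to themselves. The two have no common edge, because already the chains and
  the complemented chains have none if \<open>N \<ge> 2\<close> (lemma \<open>up_complement_up\<close>). Indeed, suppose that
  the bit at position \<open>p\<close> is the last unmatched 0 of \<open>x\<close> and that after complementing the upper end
  of the edge it is so again. Then it is the last unmatched 0 of a string with \<open>v\<close> to the right
  of \<open>p\<close> and also of one with the complement of \<open>v\<close> there. Neither \<open>v\<close> nor its complement has an
  unmatched 0, so \<open>v\<close> is empty; symmetrically, nothing is to the left of \<open>p\<close>, and \<open>N = 1\<close>.
\<close>

section \<open>Cycle factors from permutations and from matchings\<close>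

text \<open>The cycles are those of the cycle decomposition of \<open>p\<close>. Each cycle is listed once, from an
  arbitrarily chosen starting point; the absence of fixed points and of 2-cycles makes its length at
  least 3.\<close>

lemma cycle_factor_of_permutation:
  fixes G :: "'a sgraph"
  assumes "finite (vertices G)" and perm: "p permutes vertices G"
    and edge: "\<And>x. x \<in> vertices G \<Longrightarrow> {x, p x} \<in> edges G"
    and no_fix: "\<And>x. x \<in> vertices G \<Longrightarrow> p x \<noteq> x"
    and no_2cycle: "\<And>x. x \<in> vertices G \<Longrightarrow> p (p x) \<noteq> x"
  shows "\<exists>C. is_cycle_factor G C"
proof -
  have p: "permutation p"
    using assms(1) perm by (auto simp: permutation_permutes)
  define start where "start S = (SOME a. a \<in> vertices G \<and> set (support p a) = S)" for S
  define orbits where "orbits = (\<lambda>a. set (support p a)) ` vertices G"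
  have start: "start S \<in> vertices G \<and> set (support p (start S)) = S" if "S \<in> orbits" for S
    unfolding start_def by (rule someI_ex) (use that orbits_def in auto)
  have funpow_in: "(p ^^ i) a \<in> vertices G" if "a \<in> vertices G" for a i
    using that by (induction i) (auto simp: permutes_in_image[OF perm])
  have cyc: "is_cycle G (support p a)" if a: "a \<in> vertices G" for a
  proof -
    let ?k = "least_power p a"
    have k: "(p ^^ ?k) a = a" "?k > 0"
      using least_power_of_permutation[OF p] by auto
    have "?k \<noteq> 1" "?k \<noteq> 2"
      using k(1) no_fix[OF a] no_2cycle[OF a] by (auto simp: numeral_2_eq_2)
    then have "?k \<ge> 3" using k(2) by linarith
    moreover have "{(p ^^ i) a, (p ^^ (Suc i mod ?k)) a} \<in> edges G" if "i < ?k" for i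
    proof -
      have "(p ^^ (Suc i mod ?k)) a = (p ^^ Suc i) a"
        using that k(1) by (cases "Suc i = ?k") (auto simp del: funpow.simps)
      then show ?thesis using edge[OF funpow_in[OF a]] by simp
    qed
    ultimately show ?thesis
      using cycle_of_permutation[OF p, of a] funpow_in[OF a] by (auto simp: is_cycle_def)
  qed
  have "is_cycle_factor G ((\<lambda>S. support p (start S)) ` orbits)"
    unfolding is_cycle_factor_def
  proof (intro conjI ballI impI)
    fix c assume "c \<in> (\<lambda>S. support p (start S)) ` orbits"
    then show "is_cycle G c" using cyc start by auto
  next
    fix c d assume cd: "c \<in> (\<lambda>S. support p (start S)) ` orbits"
      "d \<in> (\<lambda>S. support p (start S)) ` orbits" "c \<noteq> d"
    then obtain S T where ST: "S \<in> orbits" "T \<in> orbits" "c = support p (start S)"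
      "d = support p (start T)" by auto
    then have "S \<noteq> T" using cd(3) by auto
    moreover have "disjoint orbits"
      using disjoint_support[OF p] by (rule pairwise_subset) (auto simp: orbits_def)
    ultimately show "set c \<inter> set d = {}"
      using ST start by (metis disjointD)
  next
    have "a \<in> set (support p a)" for a
      unfolding support_set[OF p] by (metis funpow_0 rangeI)
    moreover have "set (support p a) \<subseteq> vertices G" if "a \<in> vertices G" for a
      using funpow_in[OF that] by auto
    ultimately have "\<Union> orbits = vertices G"
      unfolding orbits_def by blast
    then show "(\<Union>c\<in>(\<lambda>S. support p (start S)) ` orbits. set c) = vertices G"
      using start by auto
  qed
  then show ?thesis by blast
qed

text \<open>The bipartition \<open>P\<close> orients the union of the two matchings: leave the vertices in \<open>P\<close> along
  \<open>f\<close> and the others along \<open>g\<close>. The inverse of this permutation interchanges the roles of \<open>f\<close>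
  and \<open>g\<close>.\<close>

lemma cycle_factor_of_disjoint_matchings:
  fixes G :: "'a sgraph" and P :: "'a \<Rightarrow> bool"
  assumes "finite (vertices G)"
    and f: "\<And>x. x \<in> vertices G \<Longrightarrow> f x \<in> vertices G \<and> f (f x) = x \<and> P (f x) \<noteq> P x \<and> {x, f x} \<in> edges G"
    and g: "\<And>x. x \<in> vertices G \<Longrightarrow> g x \<in> vertices G \<and> g (g x) = x \<and> P (g x) \<noteq> P x \<and> {x, g x} \<in> edges G"
    and disj: "\<And>x. x \<in> vertices G \<Longrightarrow> f x \<noteq> g x"
  shows "\<exists>C. is_cycle_factor G C"
proof -
  define s where "s x = (if x \<in> vertices G then if P x then f x else g x else x)" for x
  define t where "t x = (if P x then g x else f x)" for x
  have "bij_betw s (vertices G) (vertices G)"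
    by (rule bij_betw_byWitness[where f' = t]) (use f g in \<open>auto simp: s_def t_def\<close>)
  then have "s permutes vertices G"
    by (rule bij_imp_permutes) (simp add: s_def)
  then show ?thesis
  proof (rule cycle_factor_of_permutation[OF assms(1)])
    fix x assume x: "x \<in> vertices G"
    show "{x, s x} \<in> edges G" using f g x by (auto simp: s_def)
    show "s x \<noteq> x" using f[OF x] g[OF x] x by (auto simp: s_def)
    show "s (s x) \<noteq> x"
      using f[OF x] g[OF x] disj[OF x] x f[of "g x"] g[of "f x"] by (auto simp: s_def)
  qed
qed

section \<open>Bracket matching and symmetric chains\<close>

text \<open>The next three functions count the unmatched zeros, the unmatched ones and the matched pairs
  of a bitstring: a new bit 1 on the left is matched with the first unmatched 0, if there is one.\<close>

fun free_zeros :: "bool list \<Rightarrow> nat" where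
  "free_zeros [] = 0"
| "free_zeros (False # x) = Suc (free_zeros x)"
| "free_zeros (True # x) = free_zeros x - 1"

fun free_ones :: "bool list \<Rightarrow> nat" where
  "free_ones [] = 0"
| "free_ones (False # x) = free_ones x"
| "free_ones (True # x) = (if free_zeros x > 0 then free_ones x else Suc (free_ones x))"

fun matched :: "bool list \<Rightarrow> nat" where
  "matched [] = 0"
| "matched (False # x) = matched x"
| "matched (True # x) = (if free_zeros x > 0 then Suc (matched x) else matched x)"

text \<open>One step up along a chain turns the last unmatched 0 into a 1; one step down turns the first
  unmatched 1 into a 0. The values at the ends of a chain, where there is no such bit, are
  arbitrary.\<close>

fun up :: "bool list \<Rightarrow> bool list" where
  "up [] = []"
| "up (False # x) = (if free_zeros x = 0 then True # x else False # up x)"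
| "up (True # x) = True # up x"

fun down :: "bool list \<Rightarrow> bool list" where
  "down [] = []"
| "down (False # x) = False # down x"
| "down (True # x) = (if free_zeros x = 0 then False # x else True # down x)"

lemma hamming_weight_simps [simp]:
  "hamming_weight [] = 0"
  "hamming_weight (b # x) = of_bool b + hamming_weight x"
  by (auto simp: hamming_weight_def)

lemma hamming_weight_eq: "hamming_weight x = matched x + free_ones x"
  by (induction x rule: free_zeros.induct) auto

lemma length_eq: "length x = 2 * matched x + free_zeros x + free_ones x"
  by (induction x rule: free_zeros.induct) auto

lemma free_zeros_up: "free_zeros x > 0 \<Longrightarrow> free_zeros (up x) = free_zeros x - 1"
  by (induction x rule: free_zeros.induct) auto

lemma free_ones_up: "free_zeros x > 0 \<Longrightarrow> free_ones (up x) = Suc (free_ones x)"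
  by (induction x rule: free_zeros.induct) (auto simp: free_zeros_up)

lemma matched_up: "free_zeros x > 0 \<Longrightarrow> matched (up x) = matched x"
  by (induction x rule: free_zeros.induct) (auto simp: free_zeros_up)

lemma down_up: "free_zeros x > 0 \<Longrightarrow> down (up x) = x"
  by (induction x rule: free_zeros.induct) (auto simp: free_zeros_up)

lemma free_zeros_down: "free_ones x > 0 \<Longrightarrow> free_zeros (down x) = Suc (free_zeros x)"
  by (induction x rule: free_zeros.induct) (auto split: if_splits)

lemma up_down: "free_ones x > 0 \<Longrightarrow> up (down x) = x"
  by (induction x rule: free_zeros.induct) (auto simp: free_zeros_down split: if_splits)

lemma matched_down: "free_ones x > 0 \<Longrightarrow> matched (down x) = matched x"
  by (metis free_zeros_down matched_up up_down zero_less_Suc)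

lemma up_flips_one_bit:
  "free_zeros x > 0 \<Longrightarrow> \<exists>u v. x = u @ False # v \<and> up x = u @ True # v"
proof (induction x rule: free_zeros.induct)
  case (2 x)
  show ?case
  proof (cases "free_zeros x = 0")
    case True
    then show ?thesis by (intro exI[of _ "[]"] exI[of _ x]) simp
  next
    case False
    then obtain u v where "x = u @ False # v" "up x = u @ True # v" using 2 by auto
    then show ?thesis using False by (intro exI[of _ "False # u"] exI[of _ v]) simp
  qed
next
  case (3 x)
  then obtain u v where "x = u @ False # v" "up x = u @ True # v" by auto
  then show ?case by (intro exI[of _ "True # u"] exI[of _ v]) simp
qed simp

lemma length_up: "free_zeros x > 0 \<Longrightarrow> length (up x) = length x"
  by (induction x rule: free_zeros.induct) auto

lemma length_down: "free_ones x > 0 \<Longrightarrow> length (down x) = length x"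
  by (metis free_zeros_down length_up up_down zero_less_Suc)

lemma hamming_weight_up: "free_zeros x > 0 \<Longrightarrow> hamming_weight (up x) = Suc (hamming_weight x)"
  by (simp add: hamming_weight_eq matched_up free_ones_up)

lemma hamming_weight_down:
  "free_ones x > 0 \<Longrightarrow> Suc (hamming_weight (down x)) = hamming_weight x"
  by (metis free_zeros_down hamming_weight_up up_down zero_less_Suc)

section \<open>Chains and complemented chains\<close>

abbreviation complement :: "bool list \<Rightarrow> bool list" where
  "complement \<equiv> map Not"

lemma Not_comp_Not [simp]: "Not \<circ> Not = id"
  by auto

lemma complement_complement: "complement (complement x) = x"
  by simp

lemma hamming_weight_complement: "hamming_weight (complement x) = length x - hamming_weight x"
proof -
  have "hamming_weight (complement x) + hamming_weight x = length x"
    by (induction x) auto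
  then show ?thesis by simp
qed

text \<open>A 0 in the first position has no opening bracket to its left and is therefore unmatched, and
  the first bit is 0 in the string or in its complement.\<close>

lemma no_free_zeros_complement:
  assumes "free_zeros x = 0" and "free_zeros (complement x) = 0"
  shows "x = []"
  using assms by (cases x rule: free_zeros.cases) auto

text \<open>A common edge of a chain and a complemented chain joins some \<open>x\<close> with \<open>up x\<close> such that going
  up from the complement of \<open>up x\<close> leads to the complement of \<open>x\<close>. Both steps change the same bit.
  If it is the first bit, neither the rest of \<open>x\<close> nor its complement has an unmatched 0, and the
  rest is empty. Otherwise the first bit can be removed, and by induction the rest of \<open>x\<close> is the
  single bit 0. This case is impossible: in 10 the 0 is matched, and 00 is raised to 01, whose
  complement 10 is the top of its chain.\<close>

lemma up_complement_up:
  assumes "free_zeros x > 0" and "free_zeros (complement (up x)) > 0"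
    and "up (complement (up x)) = complement x"
  shows "length x = 1"
  using assms
proof (induction x rule: free_zeros.induct)
  case (2 x)
  show ?case
  proof (cases "free_zeros x = 0")
    case True
    then have "free_zeros (complement x) = 0" using 2 by (auto split: if_splits)
    then show ?thesis using True no_free_zeros_complement by auto
  next
    case False
    then have "length x = 1" using 2 by auto
    then obtain b where "x = [b]" by (auto simp: length_Suc_conv)
    then show ?thesis using False 2 by (cases b) auto
  qed
next
  case (3 x)
  then have "length x = 1" by (auto split: if_splits)
  then show ?case using 3 length_eq[of x] by auto
qed simp

section \<open>The matching of the middle levels\<close>

definition middle_levels :: "nat \<Rightarrow> nat \<Rightarrow> bool list set" where
  "middle_levels N a = {x. length x = N \<and> a \<le> hamming_weight x \<and> hamming_weight x + a \<le> N}"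

text \<open>Within the levels \<open>a, \<dots>, N - a\<close> the chain of \<open>x\<close> starts at level \<open>max a (matched x)\<close>. The
  vertices at even distance from this start are matched upwards, the others downwards.\<close>

definition partner :: "nat \<Rightarrow> bool list \<Rightarrow> bool list" where
  "partner a x = (if even (hamming_weight x + max a (matched x)) then up x else down x)"

lemma partner_cases:
  assumes "odd N" and "x \<in> middle_levels N a"
  obtains (up) "even (hamming_weight x + max a (matched x))" "free_zeros x > 0"
      "hamming_weight x + a < N" "partner a x = up x"
    | (down) "odd (hamming_weight x + max a (matched x))" "free_ones x > 0"
      "a < hamming_weight x" "partner a x = down x"
proof (cases "even (hamming_weight x + max a (matched x))")
  case True
  have x: "2 * matched x + free_zeros x + free_ones x = N" "a \<le> hamming_weight x"
    "hamming_weight x + a \<le> N" "hamming_weight x = matched x + free_ones x"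
    using assms length_eq[of x] hamming_weight_eq[of x] by (auto simp: middle_levels_def)
  \<comment> \<open>The top of the truncated chain is at level \<open>N - max a (matched x)\<close>, which is at odd distance
    from its bottom.\<close>
  have "hamming_weight x + max a (matched x) \<noteq> N"
    using True assms(1) by metis
  then have "free_zeros x > 0" "hamming_weight x + a < N"
    using x by (auto simp: max_def split: if_splits)
  then show thesis using True up by (simp add: partner_def)
next
  case False
  have x: "a \<le> hamming_weight x" "hamming_weight x = matched x + free_ones x"
    using assms hamming_weight_eq[of x] by (auto simp: middle_levels_def)
  have "hamming_weight x \<noteq> max a (matched x)"
    using False by auto
  then have "free_ones x > 0" "a < hamming_weight x"
    using x by (auto simp: max_def split: if_splits)
  then show thesis using False down by (simp add: partner_def)
qed

lemma partner_in_middle_levels: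
  assumes "odd N" and "x \<in> middle_levels N a"
  shows "partner a x \<in> middle_levels N a"
  using assms
proof (cases rule: partner_cases)
  case up
  then show ?thesis using assms(2) by (auto simp: middle_levels_def length_up hamming_weight_up)
next
  case down
  then show ?thesis
    using assms(2) hamming_weight_down[of x] by (auto simp: middle_levels_def length_down)
qed

lemma partner_partner:
  assumes "odd N" and "x \<in> middle_levels N a"
  shows "partner a (partner a x) = x"
  using assms
proof (cases rule: partner_cases)
  case up
  then show ?thesis by (simp add: partner_def hamming_weight_up matched_up down_up)
next
  case down
  then show ?thesis
    using hamming_weight_down[of x] even_Suc[of "hamming_weight (down x)"]
    by (simp add: partner_def matched_down up_down)
qed

lemma even_hamming_weight_partner:
  assumes "odd N" and "x \<in> middle_levels N a"
  shows "even (hamming_weight (partner a x)) \<noteq> even (hamming_weight x)"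
  using assms
proof (cases rule: partner_cases)
  case up
  then show ?thesis by (simp add: hamming_weight_up)
next
  case down
  then show ?thesis using hamming_weight_down[of x] by (metis even_Suc)
qed

text \<open>If \<open>x\<close> had the same partner in both matchings, the edge to it would lie on a chain and on
  a complemented chain, which is excluded by \<open>up_complement_up\<close>.\<close>

lemma partner_neq_complement_partner:
  assumes "odd N" and "N \<noteq> 1" and x: "x \<in> middle_levels N a"
    and cx: "complement x \<in> middle_levels N a"
  shows "partner a x \<noteq> complement (partner a (complement x))"
proof
  assume eq: "partner a x = complement (partner a (complement x))"
  then have eq': "partner a (complement x) = complement (partner a x)"
    by (metis complement_complement)
  have N: "length x = N" using x by (simp add: middle_levels_def)
  have len: "hamming_weight x \<le> N" "length (partner a x) = N" "hamming_weight (partner a x) \<le> N"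
    using x partner_in_middle_levels[OF assms(1) x] by (auto simp: middle_levels_def)
  have wt: "hamming_weight (complement x) = N - hamming_weight x"
    "hamming_weight (partner a (complement x)) = N - hamming_weight (partner a x)"
    using N len(2) by (simp_all add: eq' hamming_weight_complement)
  from assms(1) x show False
  proof (cases rule: partner_cases)
    case up
    have lt: "hamming_weight (partner a (complement x)) < hamming_weight (complement x)"
      using wt len up by (simp add: hamming_weight_up)
    from assms(1) cx show False
    proof (cases rule: partner_cases)
      case up
      then show False using lt by (simp add: hamming_weight_up)
    next
      case down
      then have "down (complement x) = complement (up x)" using eq' \<open>partner a x = up x\<close> by simp
      then have "free_zeros (complement (up x)) > 0" "up (complement (up x)) = complement x"
        using free_zeros_down[OF down(2)] up_down[OF down(2)] by auto
      then show False using up_complement_up[OF \<open>free_zeros x > 0\<close>] N assms(2) by simp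
    qed
  next
    case down
    have lt: "hamming_weight (complement x) < hamming_weight (partner a (complement x))"
      using wt len down hamming_weight_down[of x] by simp
    from assms(1) cx show False
    proof (cases rule: partner_cases)
      case up
      \<comment> \<open>The edge now has \<open>down x\<close> as its lower end.\<close>
      have "up (complement x) = complement (down x)"
        using eq' up \<open>partner a x = down x\<close> by simp
      then show False
        using up_complement_up[of "down x"] up free_zeros_down[OF down(2)] up_down[OF down(2)]
          length_down[OF down(2)] N assms(2) by simp
    next
      case down
      then show False using lt hamming_weight_down[of "complement x"] by simp
    qed
  qed
qed

section \<open>Edges of the cube and the cycle factor\<close>

lemma flip_one_bit_edge: "{u @ b # v, u @ (\<not> b) # v} \<in> edges (cube (length (u @ b # v)))"
proof -
  have "{i. i < length (u @ b # v) \<and> (u @ b # v) ! i \<noteq> (u @ (\<not> b) # v) ! i} = {length u}"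
    by (auto simp: nth_append nth_Cons' split: if_splits)
  then have "card {i. i < length (u @ b # v) \<and> (u @ b # v) ! i \<noteq> (u @ (\<not> b) # v) ! i} = 1"
    by simp
  then show ?thesis
    unfolding cube_def bitstrings_def snd_conv
    by (intro CollectI exI[of _ "u @ b # v"] exI[of _ "u @ (\<not> b) # v"]) auto
qed

lemma up_edge:
  assumes "free_zeros x > 0"
  shows "{x, up x} \<in> edges (cube (length x))"
    and "{complement x, complement (up x)} \<in> edges (cube (length x))"
proof -
  obtain u v where uv: "x = u @ False # v" "up x = u @ True # v"
    using up_flips_one_bit[OF assms] by blast
  show "{x, up x} \<in> edges (cube (length x))"
    using flip_one_bit_edge[of u False v] uv by simp
  show "{complement x, complement (up x)} \<in> edges (cube (length x))"
    using flip_one_bit_edge[of "complement u" True "complement v"] uv by simp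
qed

lemma partner_edge:
  assumes "odd N" and "x \<in> middle_levels N a"
  shows "{x, partner a x} \<in> edges (cube N)"
    and "{complement x, complement (partner a x)} \<in> edges (cube N)"
proof -
  have N: "length x = N" using assms(2) by (simp add: middle_levels_def)
  have "{x, partner a x} \<in> edges (cube N) \<and>
    {complement x, complement (partner a x)} \<in> edges (cube N)"
    using assms
  proof (cases rule: partner_cases)
    case up
    then show ?thesis using up_edge[of x] N by simp
  next
    case down
    then show ?thesis
      using up_edge[of "down x"] N free_zeros_down[of x] up_down[of x] length_down[of x]
      by (simp add: insert_commute)
  qed
  then show "{x, partner a x} \<in> edges (cube N)"
    and "{complement x, complement (partner a x)} \<in> edges (cube N)" by auto
qed

lemma complement_in_middle_levels:
  "x \<in> middle_levels N a \<Longrightarrow> complement x \<in> middle_levels N a"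
  by (auto simp: middle_levels_def hamming_weight_complement)

theorem theorem2:
  fixes n l :: nat
  assumes "n \<ge> 1" and "1 \<le> l" and "l \<le> n + 1"
  shows "\<exists>C. is_cycle_factor
    (induced_subgraph (cube (2 * n + 1)) (\<Union>k\<in>{n + 1 - l..n + l}. level (2 * n + 1) k)) C"
proof -
  define N a where "N = 2 * n + 1" and "a = n + 1 - l"
  define V where "V = middle_levels N a"
  define g where "g x = complement (partner a (complement x))" for x
  have N: "odd N" "N \<noteq> 1" using assms by (auto simp: N_def)
  have "n + l = N - a" "a \<le> N" using assms by (auto simp: N_def a_def)
  then have levels: "(\<Union>k\<in>{n + 1 - l..n + l}. level N k) = V"
    by (auto simp: V_def middle_levels_def level_def bitstrings_def a_def)
  let ?G = "induced_subgraph (cube N) V"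
  have vert: "vertices ?G = V"
    by (auto simp: induced_subgraph_def cube_def bitstrings_def V_def middle_levels_def)
  have edge: "{x, y} \<in> edges ?G" if "{x, y} \<in> edges (cube N)" "x \<in> V" "y \<in> V" for x y
    using that by (simp add: induced_subgraph_def)
  have "finite {x :: bool list. set x \<subseteq> UNIV \<and> length x = N}"
    by (rule finite_lists_length_eq) simp
  then have fin: "finite V"
    by (rule rev_finite_subset) (auto simp: V_def middle_levels_def)
  have compl: "complement x \<in> V" if "x \<in> V" for x
    using that complement_in_middle_levels by (simp add: V_def)
  have partner: "partner a x \<in> V \<and> partner a (partner a x) = x \<and>
    even (hamming_weight (partner a x)) \<noteq> even (hamming_weight x) \<and>
    {x, partner a x} \<in> edges (cube N) \<and>
    {complement x, complement (partner a x)} \<in> edges (cube N)" if "x \<in> V" for x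
    using that N partner_in_middle_levels partner_partner even_hamming_weight_partner partner_edge
    unfolding V_def by blast
  \<comment> \<open>As \<open>N\<close> is odd, complementing changes the parity of the weight.\<close>
  have parity: "even (hamming_weight (complement x)) \<longleftrightarrow> odd (hamming_weight x)" if "x \<in> V" for x
    using that N(1) by (auto simp: V_def middle_levels_def hamming_weight_complement)
  have "\<exists>C. is_cycle_factor ?G C"
  proof (rule cycle_factor_of_disjoint_matchings[where f = "partner a" and g = g
        and P = "\<lambda>x. even (hamming_weight x)"], unfold vert)
    show "finite V" by (rule fin)
    fix x assume x: "x \<in> V"
    show "partner a x \<in> V \<and> partner a (partner a x) = x \<and>
      even (hamming_weight (partner a x)) \<noteq> even (hamming_weight x) \<and> {x, partner a x} \<in> edges ?G"
      using partner[OF x] edge x by blast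
    have g: "g x \<in> V" "g (g x) = x" "{x, g x} \<in> edges (cube N)"
      using partner[OF compl[OF x]] compl by (auto simp: g_def)
    moreover have "even (hamming_weight (g x)) \<noteq> even (hamming_weight x)"
      using partner[OF compl[OF x]] parity[OF x] parity[of "partner a (complement x)"]
      by (auto simp: g_def)
    ultimately show "g x \<in> V \<and> g (g x) = x \<and>
      even (hamming_weight (g x)) \<noteq> even (hamming_weight x) \<and> {x, g x} \<in> edges ?G"
      using edge x by blast
    show "partner a x \<noteq> g x"
      using partner_neq_complement_partner[OF N] x compl[OF x] by (simp add: V_def g_def)
  qed
  then show ?thesis using levels by (simp add: N_def)
qed

end
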